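(* There exists a compact set $F\subset\mathbb{R}$ with Lebesgue measure $\mathcal{L}^1(F)>0$ such that it contains no non-empty $s$-regular subset for any $s>0$.
   Context: $B(x,r)$ denotes the closed ball with center $x$ and radius $r$; $d(E)$ denotes the diameter of $E$; $\mathcal{L}^1$ denotes Lebesgue measure on $\mathbb{R}$. Regular sets: let $X$ be a metric space (here $X=\mathbb{R}$), $E\subset X$ and $0<s<\infty$. The set $E$ is $s$-regular if it is closed and if there exist a Borel (outer) measure $\mu$ on $X$ and a constant $C_E$, $1\le C_E<\infty$, such that $\mu(X\setminus E)=0$ and $$r^s\le \mu(B(x,r))\le C_E r^s\quad\text{for all } x\in E,\ 0<r\le d(E),\ r<\infty.$$
   Formalization: The non-empty s-regular subsets are required to have positive diameter, i.e. more than one point, since by the given definition every one-point set is vacuously s-regular for every s > 0. *)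

theory Defs
  imports "HOL-Analysis.Analysis"
begin

text \<open>
  A Borel measure is a measure on the Borel sigma-algebra; only the values on the open set
  \<open>- E\<close> and on closed balls matter, so the choice between an outer measure with measurable
  Borel sets and its restriction to the Borel sets is immaterial.
  The library constant \<^const>\<open>diameter\<close> is only meaningful for bounded sets. An unbounded set has
  infinite diameter, so no upper bound is then imposed on \<open>r\<close>.
\<close>

definition s_regular :: "real \<Rightarrow> 'a::metric_space set \<Rightarrow> bool" where
  "s_regular s E \<longleftrightarrow> 0 < s \<and> closed E \<and>
     (\<exists>(M :: 'a measure) (C :: real). sets M = sets borel \<and> 1 \<le> C \<and> emeasure M (- E) = 0 \<and>
        (\<forall>x\<in>E. \<forall>r>0. (bounded E \<longrightarrow> r \<le> diameter E) \<longrightarrow>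
           ennreal (r powr s) \<le> emeasure M (cball x r) \<and>
           emeasure M (cball x r) \<le> ennreal (C * r powr s)))"

text \<open>
  A one-point set has diameter \<open>0\<close>, so the range of \<open>r\<close> is empty and the set is vacuously
  \<open>s\<close>-regular for every \<open>s > 0\<close>. Claims that a set has no non-empty regular subset
  therefore have to be read as being about subsets of positive diameter.
\<close>

lemma s_regular_singleton:
  assumes "0 < s"
  shows "s_regular s {x}"
  unfolding s_regular_def
  using assms by (intro conjI exI[of _ "null_measure borel"] exI[of _ "1::real"]) auto

end

theory Submission imports Defs begin

text \<open>
  A regular set is uniformly perfect: it has no proper part that is \<open>K\<close>-isolated, once \<open>K\<close> is large.
  In an interval \<open>I\<close>, keep the concentric interval \<open>J\<close> with \<open>|J| = |I| / K\<close> and, on the two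
  remaining sides, a set that a uniformly perfect set cannot meet. Then a uniformly perfect set
  meeting the interior of \<open>I\<close> only in this set has an isolated part in \<open>J\<close>; so it is either
  contained in \<open>J\<close> or misses \<open>I\<close> altogether. Hence the construction can be iterated, and after \<open>m\<close>
  rounds only the proportion \<open>(1 - 1/K)^m\<close> of \<open>I\<close> has been removed. Intersecting such sets over all
  \<open>K\<close>, with summably small removed parts, gives \<open>F\<close>: a regular subset of it has arbitrarily small
  diameter.
\<close>

text \<open>The classical condition that annuli of large ratio around points of the set meet it,
  except that \<open>c\<close> need not lie in \<open>E\<close>: it will be the midpoint of an
  interval.\<close>

definition uniformly_perfect :: "real \<Rightarrow> 'a::metric_space set \<Rightarrow> bool" where
  "uniformly_perfect K E \<longleftrightarrow>
     (\<forall>c. \<forall>h>0. E \<inter> ball c (K * h) \<subseteq> cball c h \<longrightarrow> E \<inter> ball c (K * h) = {} \<or> E \<subseteq> cball c h)"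

text \<open>Around a point of a proper isolated part, balls of radius \<open>2 * h\<close> and of a
  much larger radius \<open>R\<close> would have equal mass, whereas regularity makes the mass grow
  like \<open>r powr s\<close>.\<close>

lemma s_regular_uniformly_perfect:
  fixes E :: "'a::metric_space set"
  assumes "s_regular s E"
  obtains K0 where "\<And>K. K \<ge> K0 \<Longrightarrow> uniformly_perfect K E"
proof -
  obtain M :: "'a measure" and C :: real where s: "0 < s" and cl: "closed E"
    and M: "sets M = sets borel" and C: "1 \<le> C" and null: "emeasure M (- E) = 0"
    and lower: "\<And>x r. \<lbrakk>x \<in> E; r > 0; bounded E \<Longrightarrow> r \<le> diameter E\<rbrakk> \<Longrightarrow>
      ennreal (r powr s) \<le> emeasure M (cball x r)"
    and upper: "\<And>x r. \<lbrakk>x \<in> E; r > 0; bounded E \<Longrightarrow> r \<le> diameter E\<rbrakk> \<Longrightarrow>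
      emeasure M (cball x r) \<le> ennreal (C * r powr s)"
    using assms unfolding s_regular_def by blast
  \<comment> \<open>The ratio of \<open>R\<close> to \<open>2 * h\<close>, chosen so that
    \<open>t powr s = 2 powr s * C\<close> exceeds \<open>C\<close>.\<close>
  define t where "t = 2 * C powr (1 / s)"
  have t: "t \<ge> 2"
    using C s by (simp add: t_def ge_one_powr_ge_zero)
  have "uniformly_perfect K E" if K: "K \<ge> 2 * t + 2" for K
    unfolding uniformly_perfect_def
  proof (intro allI impI)
    fix c and h :: real
    assume h: "h > 0" and sub: "E \<inter> ball c (K * h) \<subseteq> cball c h"
    show "E \<inter> ball c (K * h) = {} \<or> E \<subseteq> cball c h"
    proof (rule ccontr)
      assume contr: "\<not> ?thesis"
      then obtain x where x: "x \<in> E" "x \<in> cball c h"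
        using sub by blast
      define R where "R = 2 * t * h"
      have "R + h < K * h"
        using h mult_right_mono[OF K, of h] by (simp add: R_def algebra_simps)
      have R: "2 * h \<le> R"
        using t h by (simp add: R_def)
      have "cball x R \<subseteq> ball c (K * h)"
      proof
        fix y assume "y \<in> cball x R"
        then show "y \<in> ball c (K * h)"
          using x(2) \<open>R + h < K * h\<close> dist_triangle[of c y x] by simp
      qed
      then have ER: "E \<inter> cball x R \<subseteq> cball c h"
        using sub by blast
      \<comment> \<open>Regularity controls only radii up to the diameter. Were \<open>R\<close>
        larger, all of \<open>E\<close> would lie in \<open>cball x R\<close>, hence in
        \<open>cball c h\<close>.\<close>
      have bd: "R \<le> diameter E" if "bounded E"
      proof (rule ccontr)
        assume "\<not> R \<le> diameter E"
        then have "E \<subseteq> cball x R"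
          using diameter_bounded_bound[OF that x(1)] by fastforce
        then show False
          using ER contr by blast
      qed
      have cb: "cball c h \<subseteq> cball x (2 * h)"
      proof
        fix y assume "y \<in> cball c h"
        then show "y \<in> cball x (2 * h)"
          using x(2) dist_triangle[of x y c] by (simp add: dist_commute)
      qed
      have "ennreal (R powr s) \<le> emeasure M (cball x R)"
        using lower x(1) bd R h by simp
      \<comment> \<open>Between the two balls there are no points of \<open>E\<close>, and
        \<open>M\<close> gives no mass to \<open>- E\<close>.\<close>
      also have "\<dots> \<le> emeasure M (cball x (2 * h) \<union> - E)"
        using ER cb cl by (intro emeasure_mono) (auto simp: M)
      also have "\<dots> \<le> emeasure M (cball x (2 * h)) + emeasure M (- E)"
        using cl by (intro emeasure_subadditive) (auto simp: M)
      also have "\<dots> \<le> ennreal (C * (2 * h) powr s)"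
        using upper[of x "2 * h"] x(1) bd R h null by force
      finally have "R powr s \<le> C * (2 * h) powr s"
        using C by (simp add: ennreal_le_iff)
      moreover have "R powr s = (2 powr s * C) * (2 * h) powr s"
      proof -
        have "R = (2 * C powr (1 / s)) * (2 * h)"
          by (simp add: R_def t_def)
        then have "R powr s = (2 powr s * (C powr (1 / s)) powr s) * (2 * h) powr s"
          by (simp only: powr_mult)
        then show ?thesis
          using C s by (simp add: powr_powr)
      qed
      moreover have "2 powr s > (1 :: real)"
        using s by simp
      moreover have "C * (2 * h) powr s > 0"
        using C h by simp
      ultimately show False
        using mult_strict_right_mono[of 1 "2 powr s" "C * (2 * h) powr s"]
        by (simp add: mult.assoc)
    qed
  qed
  then show thesis
    using that by blast
qed

text \<open>Induction on \<open>m\<close> for all intervals: keep the middle and apply the induction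
  hypothesis to both sides. Requiring that no ball of radius \<open>r\<close> contains
  \<open>E\<close> excludes that \<open>E\<close> lies inside a kept middle;
  \<open>b - a \<le> 2 * K * r\<close> makes every middle short enough for this and passes to
  subintervals.\<close>

lemma exists_avoided_compact:
  fixes K r :: real
  assumes K: "K > 1" and "a < b" "b - a \<le> 2 * K * r"
  shows "\<exists>A. compact A \<and> A \<subseteq> {a..b} \<and>
    emeasure lborel ({a..b} - A) \<le> ennreal ((1 - 1 / K) ^ m * (b - a)) \<and>
    (\<forall>E. uniformly_perfect K E \<longrightarrow> (\<nexists>c. E \<subseteq> cball c r) \<longrightarrow> E \<inter> {a<..<b} \<subseteq> A \<longrightarrow>
      E \<inter> {a<..<b} = {})"
  using assms(2,3)
proof (induction m arbitrary: a b)
  case 0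
  then show ?case
    by (intro exI[of _ "{}"]) auto
next
  case (Suc m)
  \<comment> \<open>With this \<open>h\<close>, \<open>ball c (K * h)\<close> is the open interval
    and \<open>cball c h\<close> is the middle of length \<open>(b - a) / K\<close>.\<close>
  define c h where "c = (a + b) / 2" and "h = (b - a) / (2 * K)"
  have h: "h > 0" and hr: "h \<le> r"
    using Suc.prems K by (simp_all add: h_def field_simps)
  have Kh: "c - K * h = a" "c + K * h = b"
    using K by (simp_all add: c_def h_def field_simps)
  moreover have "h < K * h"
    using K h by simp
  ultimately have ab: "a < c - h" "c + h < b"
    by linarith+
  have gap: "ball c (K * h) = {a<..<b}"
    by (simp add: ball_eq_greaterThanLessThan Kh)
  have J: "cball c h = {c - h..c + h}"
    by (simp add: cball_eq_atLeastAtMost)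
  obtain A1 where A1: "compact A1" "A1 \<subseteq> {a..c - h}"
    "emeasure lborel ({a..c - h} - A1) \<le> ennreal ((1 - 1 / K) ^ m * (c - h - a))"
    and avoid1: "\<And>E. \<lbrakk>uniformly_perfect K E; \<nexists>c. E \<subseteq> cball c r; E \<inter> {a<..<c - h} \<subseteq> A1\<rbrakk> \<Longrightarrow>
      E \<inter> {a<..<c - h} = {}"
    using Suc.IH[of a "c - h"] Suc.prems ab h by auto
  obtain A2 where A2: "compact A2" "A2 \<subseteq> {c + h..b}"
    "emeasure lborel ({c + h..b} - A2) \<le> ennreal ((1 - 1 / K) ^ m * (b - (c + h)))"
    and avoid2: "\<And>E. \<lbrakk>uniformly_perfect K E; \<nexists>c. E \<subseteq> cball c r; E \<inter> {c + h<..<b} \<subseteq> A2\<rbrakk> \<Longrightarrow>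
      E \<inter> {c + h<..<b} = {}"
    using Suc.IH[of "c + h" b] Suc.prems ab h by auto
  define A where "A = A1 \<union> cball c h \<union> A2"
  have "compact A"
    using A1 A2 by (simp add: A_def compact_Un)
  moreover have "A \<subseteq> {a..b}"
    using A1(2) A2(2) ab h unfolding A_def J by fastforce
  moreover have "emeasure lborel ({a..b} - A) \<le> ennreal ((1 - 1 / K) ^ Suc m * (b - a))"
  proof -
    have meas: "{a..c - h} - A1 \<in> sets lborel" "{c + h..b} - A2 \<in> sets lborel"
      using A1(1) A2(1) by (simp_all add: borel_compact sets.Diff)
    have "{a..b} - A \<subseteq> ({a..c - h} - A1) \<union> ({c + h..b} - A2)"
      by (auto simp: A_def J)
    then have "emeasure lborel ({a..b} - A)
        \<le> emeasure lborel (({a..c - h} - A1) \<union> ({c + h..b} - A2))"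
      using meas by (intro emeasure_mono) auto
    also have "\<dots> \<le> emeasure lborel ({a..c - h} - A1) + emeasure lborel ({c + h..b} - A2)"
      using meas by (rule emeasure_subadditive)
    also have "\<dots> \<le> ennreal ((1 - 1 / K) ^ m * (c - h - a)) + ennreal ((1 - 1 / K) ^ m * (b - (c + h)))"
      using A1(3) A2(3) by (rule add_mono)
    also have "\<dots> = ennreal ((1 - 1 / K) ^ m * (c - h - a) + (1 - 1 / K) ^ m * (b - (c + h)))"
      using K ab by (intro ennreal_plus[symmetric]) auto
    also have "(1 - 1 / K) ^ m * (c - h - a) + (1 - 1 / K) ^ m * (b - (c + h))
        = (1 - 1 / K) ^ m * (b - a - 2 * h)"
      by (simp add: algebra_simps)
    also have "b - a - 2 * h = (1 - 1 / K) * (b - a)"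
      using K by (simp add: h_def field_simps)
    finally show ?thesis
      by (simp add: mult_ac)
  qed
  moreover have "E \<inter> {a<..<b} = {}"
    if E: "uniformly_perfect K E" "\<nexists>c. E \<subseteq> cball c r" "E \<inter> {a<..<b} \<subseteq> A" for E
  proof -
    \<comment> \<open>Each open side is disjoint from the middle and from the set kept on the other
      side. The endpoints \<open>c - h\<close> and \<open>c + h\<close> belong to the middle, so the
      open sides suffice.\<close>
    have "E \<inter> {a<..<c - h} \<subseteq> A1" "E \<inter> {c + h<..<b} \<subseteq> A2"
      using E(3) A1(2) A2(2) ab h unfolding A_def J by fastforce+
    then have "E \<inter> {a<..<c - h} = {}" "E \<inter> {c + h<..<b} = {}"
      using avoid1 avoid2 E(1,2) by auto
    then have "E \<inter> ball c (K * h) \<subseteq> cball c h"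
      unfolding gap J by fastforce
    then have "E \<inter> ball c (K * h) = {} \<or> E \<subseteq> cball c h"
      using E(1) h unfolding uniformly_perfect_def by blast
    moreover have "\<not> E \<subseteq> cball c h"
      using E(2) hr by (meson order_trans subset_cball)
    ultimately show ?thesis
      by (simp add: gap)
  qed
  ultimately show ?case
    by blast
qed

theorem mainTheorem6:
  "\<exists>F :: real set. compact F \<and> 0 < emeasure lebesgue F \<and>
     (\<forall>s>0. \<not> (\<exists>E. E \<subseteq> F \<and> E \<noteq> {} \<and> 0 < diameter E \<and> s_regular s E))"
proof -
  \<comment> \<open>As \<open>K n\<close> grows, the radius \<open>1 / (2 * K n)\<close>, the least
    one allowed for the unit interval, tends to \<open>0\<close>.\<close>
  define K :: "nat \<Rightarrow> real" where "K n = real n + 2" for n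
  define avoided where "avoided n A \<longleftrightarrow>
    (\<forall>E. uniformly_perfect (K n) E \<longrightarrow> (\<nexists>c. E \<subseteq> cball c (1 / (2 * K n))) \<longrightarrow>
      E \<inter> {0<..<1} \<subseteq> A \<longrightarrow> E \<inter> {0<..<1} = {})" for n and A :: "real set"
  have "\<exists>A. compact A \<and> emeasure lborel ({0..1} - A) \<le> ennreal ((1/2) ^ Suc n / 4) \<and>
    avoided n A" for n
  proof -
    have Kn: "K n > 1"
      by (simp add: K_def)
    obtain m where m: "(1 - 1 / K n) ^ m < (1/2) ^ Suc n / 4"
      using real_arch_pow_inv[of "(1/2) ^ Suc n / 4" "1 - 1 / K n"] Kn by auto
    have le: "1 - 0 \<le> 2 * K n * (1 / (2 * K n))"
      using Kn by simp
    show ?thesis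
    proof (rule ex_forward[OF exists_avoided_compact[OF Kn zero_less_one le, of m]],
        elim conjE, intro conjI)
      fix A :: "real set"
      assume "emeasure lborel ({0..1} - A) \<le> ennreal ((1 - 1 / K n) ^ m * (1 - 0))"
      also have "\<dots> \<le> ennreal ((1/2) ^ Suc n / 4)"
        using m by (intro ennreal_leI) simp
      finally show "emeasure lborel ({0..1} - A) \<le> ennreal ((1/2) ^ Suc n / 4)" .
    qed (simp_all add: avoided_def)
  qed
  then obtain A where A: "\<And>n. compact (A n)"
    "\<And>n. emeasure lborel ({0..1} - A n) \<le> ennreal ((1/2) ^ Suc n / 4)"
    and avoid: "\<And>n. avoided n (A n)"
    by metis
  \<comment> \<open>\<open>avoided\<close> speaks only of the open unit interval; cutting down to
    \<open>{1/4..3/4}\<close> puts all of \<open>F\<close> inside it.\<close>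
  define F where "F = {1/4..3/4} \<inter> (\<Inter>n. A n)"
  have cF: "compact F"
    unfolding F_def using A(1) by (intro compact_Int_closed closed_INT) (auto intro: compact_imp_closed)
  have "0 < emeasure lebesgue F"
  proof (rule ccontr)
    assume "\<not> ?thesis"
    then have F0: "emeasure lborel F = 0"
      using cF by (simp add: borel_compact)
    have meas: "range (\<lambda>n. {0..1} - A n) \<subseteq> sets lborel"
      using A(1) by (auto simp: borel_compact sets.Diff)
    then have sets: "F \<in> sets lborel" "(\<Union>n. {0..1} - A n) \<in> sets lborel"
      using cF by (simp_all only: sets.countable_UN sets_lborel borel_compact)
    \<comment> \<open>The removed parts have total length at most \<open>1/4\<close>, too little to
      cover an interval of length \<open>1/2\<close>.\<close>
    have "ennreal (1/2) = emeasure lborel {1/4..3/4 :: real}"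
      by simp
    also have "\<dots> \<le> emeasure lborel (F \<union> (\<Union>n. {0..1} - A n))"
      by (rule emeasure_mono[OF _ sets.Un[OF sets]]) (auto simp: F_def)
    also have "\<dots> \<le> emeasure lborel F + emeasure lborel (\<Union>n. {0..1} - A n)"
      using sets by (rule emeasure_subadditive)
    also have "\<dots> \<le> (\<Sum>n. emeasure lborel ({0..1} - A n))"
      using emeasure_subadditive_countably[OF meas] F0 by simp
    also have "\<dots> \<le> (\<Sum>n. ennreal ((1/2) ^ Suc n / 4))"
      using A(2) by (intro suminf_le) auto
    also have "\<dots> = ennreal (1/4)"
      using sums_divide[OF power_half_series, of 4] by (intro suminf_ennreal_eq) auto
    finally show False
      by (subst (asm) ennreal_le_iff) simp_all
  qed
  moreover have False if E: "E \<subseteq> F" "E \<noteq> {}" "0 < diameter E" "s_regular s E" for E s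
  proof -
    obtain K0 where K0: "\<And>K. K \<ge> K0 \<Longrightarrow> uniformly_perfect K E"
      using s_regular_uniformly_perfect[OF E(4)] by blast
    \<comment> \<open>One \<open>n\<close> serves both purposes: \<open>K n \<ge> K0\<close> and
      \<open>1 / K n < diameter E\<close>.\<close>
    obtain n where n: "real n \<ge> max K0 (1 / diameter E)"
      using real_arch_simple by blast
    have "uniformly_perfect (K n) E"
      using n by (intro K0) (simp add: K_def)
    moreover have "\<not> E \<subseteq> cball c (1 / (2 * K n))" for c
    proof
      assume "E \<subseteq> cball c (1 / (2 * K n))"
      then have "diameter E \<le> diameter (cball c (1 / (2 * K n)))"
        by (intro diameter_subset) auto
      also have "\<dots> = 1 / K n"
        by (simp add: K_def divide_simps)
      also have "\<dots> < diameter E"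
      proof -
        have "1 / diameter E < K n"
          using n by (simp add: K_def)
        then show ?thesis
          using E(3) by (simp add: K_def field_simps)
      qed
      finally show False
        by simp
    qed
    moreover have "E \<inter> {0<..<1} \<subseteq> A n"
      using E(1) by (auto simp: F_def)
    ultimately have "E \<inter> {0<..<1} = {}"
      using avoid[of n] unfolding avoided_def by blast
    then show False
      using E(1,2) unfolding F_def by fastforce
  qed
  ultimately show ?thesis
    using cF by blast
qed

end
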